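(* Let $I=[\alpha,\beta]\subset[0,1]$ be an interval with $\alpha<\beta$, and let $F(x,y)=\frac12\left(\frac{x}{y}+\frac{y}{x}\right)$. For real $\delta>0$ let $Q$ be the integer part of $\frac{1}{\sqrt{2\delta}}$. Then for every real $\epsilon>0$, as $\delta\to0^+$, $$M_{F,I,\delta}(\mathcal{F})=\frac{9}{2\pi^2}Q^2+O_{I,\epsilon}\left(Q^{7/4+\epsilon}\right),$$ where the implied constant depends only on $I$ and $\epsilon$.
   Context: For a positive integer $Q$, $\mathcal F(Q)=\{p/q : 0\le p\le q\le Q,\ q\geq 1,\ \gcd(p,q)=1\}$ is the set of Farey fractions of order $Q$. For $I=[\alpha,\beta]\subset[0,1]$, write $\mathcal F(Q)\cap I=\{p_1/q_1<p_2/q_2<\dots<p_{N_I(Q)}/q_{N_I(Q)}\}$ with all fractions in lowest terms, so $N_I(Q)$ is the cardinality of this set. For $1\le j\le N_I(Q)-1$ put $x_j=q_j/Q$ and $y_j=q_{j+1}/Q$; then $(x_j,y_j)\in\Omega=\{(x,y)\in(0,1]^2 : x+y>1\}$. Given $\delta>0$, set $Q=\lfloor(2\delta)^{-1/2}\rfloor$. For a measurable function $F:\Omega\to\mathbb{R}$ the moment of $F$ is $$M_{F,I,\delta}(\mathcal F)=\frac{1}{|I|}\sum_{j=1}^{N_I(Q)-1}|F(x_j,y_j)|,\qquad |I|=\beta-\alpha.$$ *)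

theory Defs
  imports Complex_Main "HOL-Library.Landau_Symbols"
begin

definition farey :: "nat \<Rightarrow> rat set" where
  "farey Q = {of_nat p / of_nat q | p q :: nat. p \<le> q \<and> q \<le> Q \<and> 1 \<le> q \<and> coprime p q}"

definition farey_in :: "nat \<Rightarrow> real \<Rightarrow> real \<Rightarrow> rat set" where
  "farey_in Q \<alpha> \<beta> = {r \<in> farey Q. of_rat r \<in> {\<alpha>..\<beta>}}"

definition farey_count :: "nat \<Rightarrow> real \<Rightarrow> real \<Rightarrow> nat" where
  "farey_count Q \<alpha> \<beta> = card (farey_in Q \<alpha> \<beta>)"

text \<open>The denominator in lowest terms of the \<open>j\<close>-th smallest element of
  \<open>farey_in Q \<alpha> \<beta>\<close>, counted from 1; meaningful for \<open>1 \<le> j \<le> farey_count Q \<alpha> \<beta>\<close>.\<close>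

definition farey_den :: "nat \<Rightarrow> real \<Rightarrow> real \<Rightarrow> nat \<Rightarrow> int" where
  "farey_den Q \<alpha> \<beta> j = snd (quotient_of (sorted_list_of_set (farey_in Q \<alpha> \<beta>) ! (j - 1)))"

definition farey_order :: "real \<Rightarrow> nat" where
  "farey_order \<delta> = nat \<lfloor>1 / sqrt (2 * \<delta>)\<rfloor>"

text \<open>\<open>F\<close> is total on \<open>real \<times> real\<close>; only its values on
  \<open>{(x, y). 0 < x \<le> 1, 0 < y \<le> 1, x + y > 1}\<close> enter, because two neighbours in
  \<open>farey_in Q \<alpha> \<beta>\<close> are neighbours in \<open>farey Q\<close>. The half-open range \<open>{1..<N}\<close> stands for
  \<open>1 \<le> j \<le> N - 1\<close> and is empty for \<open>N \<le> 1\<close>.\<close>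

definition farey_moment :: "(real \<Rightarrow> real \<Rightarrow> real) \<Rightarrow> real \<Rightarrow> real \<Rightarrow> real \<Rightarrow> real" where
  "farey_moment F \<alpha> \<beta> \<delta> =
     (let Q = farey_order \<delta> in
      1 / (\<beta> - \<alpha>) *
      (\<Sum>j \<in> {1..<farey_count Q \<alpha> \<beta>}.
         \<bar>F (of_int (farey_den Q \<alpha> \<beta> j) / of_nat Q)
            (of_int (farey_den Q \<alpha> \<beta> (j + 1)) / of_nat Q)\<bar>))"

end

theory Submission
  imports Defs "HOL-Analysis.Gamma_Function"
begin

text \<open>
  Up to the factor \<open>1 / (2 |I|)\<close> and boundary terms, the moment is the sum of the indices
  \<open>(q\<^sub>j\<^sub>-\<^sub>1 + q\<^sub>j\<^sub>+\<^sub>1) / q\<^sub>j\<close> over the fractions in \<open>I\<close>. When \<open>Q\<close> grows by one, every new fraction is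
  the mediant of two neighbours; it has index 1 and raises the index of each of its two parents
  by 1. Hence the sum of indices grows by 3 for each new fraction in \<open>I\<close>, except that a bounded
  number of mediants have a parent on the other side of an endpoint of \<open>I\<close>. So the
  sum is \<open>3 N\<^sub>I(Q) + O(Q)\<close>, and no estimate of Kloosterman sums is needed. The count
  \<open>N\<^sub>I(Q) = 3 |I| Q\<^sup>2 / \<pi>\<^sup>2 + O(Q\<^sup>7\<^sup>/\<^sup>4)\<close> follows by counting all pairs \<open>(p, q)\<close> with \<open>p / q \<in> I\<close>
  and \<open>q \<le> Q\<close> according to their gcd, and solving the resulting recursion by induction.
\<close>

subsection \<open>Asymptotics from sums over floor quotients\<close>

text \<open>By convexity, the value of \<open>t^(-7/4)\<close> at the midpoint is at most its
  integral over the unit interval centred at \<open>d\<close>. Centring is what makes the bound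
  sharp enough: comparison with the integral over \<open>[1, \<infinity>)\<close> would bound the
  sum over \<open>d \<ge> 2\<close> only by \<open>4/3\<close>, while the later induction requires a
  constant below 1.\<close>

lemma powr_midpoint_le:
  fixes d :: real
  assumes "d \<ge> 1"
  shows "d powr (-7/4) \<le> 4/3 * ((d - 1/2) powr (-3/4) - (d + 1/2) powr (-3/4))"
proof -
  \<comment> \<open>\<open>h t\<close> is the integral of \<open>x^(-7/4)\<close> over
    \<open>[d - t, d + t]\<close> minus its midpoint estimate, so \<open>h 0 = 0\<close>, and
    \<open>h'\<close> is its derivative.\<close>
  define h where "h t = 4/3 * ((d - t) powr (-3/4) - (d + t) powr (-3/4)) - 2 * t * d powr (-7/4)" for t
  define h' where "h' t = (d - t) powr (-7/4) + (d + t) powr (-7/4) - 2 * d powr (-7/4)" for t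
  have "h 0 \<le> h (1/2)"
  proof (rule DERIV_nonneg_imp_nondecreasing[of 0 "1/2" h])
    fix t :: real
    assume t: "0 \<le> t" "t \<le> 1/2"
    have "(h has_real_derivative h' t) (at t)"
      unfolding h_def h'_def using t assms
      by (auto intro!: derivative_eq_intros simp: algebra_simps)
    moreover have "h' t \<ge> 0"
    proof -
      \<comment> \<open>Half powers, so that \<open>2ab \<le> a^2 + b^2\<close> applies and
        \<open>ab\<close> is a power of \<open>(d - t)(d + t) \<le> d^2\<close>.\<close>
      define a b where "a = (d - t) powr (-7/8)" and "b = (d + t) powr (-7/8)"
      have sq: "(d - t) powr (-7/4) = a\<^sup>2" "(d + t) powr (-7/4) = b\<^sup>2" "d powr (-7/4) = (d*d) powr (-7/8)"
        using t assms by (auto simp: a_def b_def powr_powr powr_mult power2_eq_square simp flip: powr_add)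
      have "(d * d) powr (-7/8) \<le> ((d - t) * (d + t)) powr (-7/8)"
      proof (rule powr_mono2')
        show "0 < (d - t) * (d + t)" using t assms by auto
        show "(d - t) * (d + t) \<le> d * d" by (simp add: algebra_simps)
      qed auto
      also have "\<dots> = a * b" using t assms by (simp add: a_def b_def powr_mult)
      finally have "2 * d powr (-7/4) \<le> 2 * a * b" using sq by simp
      also have "\<dots> \<le> a\<^sup>2 + b\<^sup>2" by (rule sum_squares_bound)
      finally show ?thesis unfolding h'_def sq(1,2) by simp
    qed
    ultimately show "\<exists>y. (h has_real_derivative y) (at t) \<and> y \<ge> 0" by blast
  qed auto
  then show ?thesis by (simp add: h_def)
qed

text \<open>The value of \<open>\<integral> t\<^sup>-\<^sup>7\<^sup>/\<^sup>4 dt\<close> over \<open>[3/2, \<infinity>)\<close>, which bounds \<open>\<zeta>(7/4) - 1\<close>.\<close>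

definition zeta_bound :: real where "zeta_bound = 4/3 * (3/2) powr (-3/4)"

text \<open>After taking fourth powers this is \<open>256/81 < 27/8\<close>. The strict inequality
  makes the recursion for the counting error a contraction.\<close>

lemma zeta_bound_less_1: "zeta_bound < 1"
proof -
  have "(4/3) < (3/2::real) powr (3/4)"
  proof (rule ccontr)
    assume "\<not> ?thesis"
    then have "((3/2::real) powr (3/4)) ^ 4 \<le> (4/3) ^ 4" by (intro power_mono) auto
    moreover have "((3/2::real) powr (3/4)) ^ 4 = (3/2) ^ 3"
      by (simp add: powr_power)
    ultimately show False by (simp add: power_divide)
  qed
  then show ?thesis by (simp add: zeta_bound_def powr_minus field_simps)
qed

lemma sum_powr_tail_le: "(\<Sum>d=2..n. real d powr (-7/4)) \<le> zeta_bound"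
proof -
  \<comment> \<open>The subtracted term is the integral beyond \<open>n + 1/2\<close>; keeping it
    lets the induction telescope.\<close>
  have *: "(\<Sum>d=2..n. real d powr (-7/4)) \<le> zeta_bound - 4/3 * (real n + 1/2) powr (-3/4)" if "n \<ge> 1" for n
    using that
  proof (induction n rule: nat_induct_at_least)
    case base
    then show ?case by (simp add: zeta_bound_def)
  next
    case (Suc n)
    have "(\<Sum>d=2..Suc n. real d powr (-7/4)) = (\<Sum>d=2..n. real d powr (-7/4)) + real (Suc n) powr (-7/4)"
      using Suc.hyps by simp
    also have "real (Suc n) powr (-7/4)
        \<le> 4/3 * ((real n + 1/2) powr (-3/4) - (real (Suc n) + 1/2) powr (-3/4))"
      using powr_midpoint_le[of "real (Suc n)"] by (simp add: algebra_simps)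
    finally show ?case using Suc.IH by (simp add: algebra_simps)
  qed
  show ?thesis
  proof (cases "n \<ge> 1")
    case True
    then show ?thesis using *[of n] powr_ge_zero[of "real n + 1/2" "-3/4"] by linarith
  next
    case False
    then show ?thesis by (simp add: zeta_bound_def)
  qed
qed

lemma sum_powr_div_le: "(\<Sum>d=2..n. real (n div d) powr (7/4)) \<le> zeta_bound * real n powr (7/4)"
proof -
  have "real (n div d) powr (7/4) \<le> real d powr (-7/4) * real n powr (7/4)" if "d \<in> {2..n}" for d
  proof -
    have "real (n div d) powr (7/4) \<le> (real n / real d) powr (7/4)"
      by (intro powr_mono2) (auto simp: of_nat_div_le_of_nat)
    also have "\<dots> = real d powr (-7/4) * real n powr (7/4)"
      using that by (simp add: powr_divide powr_minus field_simps)
    finally show ?thesis .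
  qed
  then have "(\<Sum>d=2..n. real (n div d) powr (7/4)) \<le> (\<Sum>d=2..n. real d powr (-7/4)) * real n powr (7/4)"
    by (auto simp: sum_distrib_right intro: sum_mono)
  also have "\<dots> \<le> zeta_bound * real n powr (7/4)"
    by (intro mult_right_mono sum_powr_tail_le) auto
  finally show ?thesis .
qed

text \<open>The partial sums increase to their limit, while adding \<open>1/n\<close> to them gives
  a sequence decreasing to the same limit, because
  \<open>1/(n+2)^2 \<le> 1/(n+1) - 1/(n+2)\<close>.\<close>

lemma inverse_squares_partial_sum:
  assumes "n \<ge> 1"
  shows "(\<Sum>d=1..n. 1 / (real d)\<^sup>2) \<in> {pi\<^sup>2 / 6 - 1 / real n .. pi\<^sup>2 / 6}"
proof -
  define s where "s n = (\<Sum>d=1..n. 1 / (real d)\<^sup>2)" for n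
  have s_eq: "s = (\<lambda>n. \<Sum>d<n. 1 / (real d + 1)\<^sup>2)"
    unfolding s_def by (rule ext) (simp add: sum.atLeast1_atMost_eq add.commute)
  have lim: "s \<longlonglongrightarrow> pi\<^sup>2 / 6"
    using inverse_squares_sums unfolding s_eq sums_def by (simp add: add.commute)
  have "incseq s" by (rule incseq_SucI) (simp add: s_def)
  then have 1: "s n \<le> pi\<^sup>2 / 6" using lim incseq_le by blast
  have "(\<lambda>n. s (Suc n) + 1 / real (Suc n)) \<longlonglongrightarrow> pi\<^sup>2 / 6 + 0"
    by (intro tendsto_add LIMSEQ_Suc lim lim_1_over_n) 
  moreover have "decseq (\<lambda>n. s (Suc n) + 1 / real (Suc n))"
  proof (rule decseq_SucI)
    fix n
    have "1 / (real n + 2)\<^sup>2 \<le> 1 / ((real n + 1) * (real n + 2))"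
      by (intro divide_left_mono) (auto simp: power2_eq_square intro: mult_right_mono)
    also have "\<dots> = 1 / (real n + 1) - 1 / (real n + 2)" by (simp add: field_simps)
    finally show "s (Suc (Suc n)) + 1 / real (Suc (Suc n)) \<le> s (Suc n) + 1 / real (Suc n)"
      by (simp add: s_def add.commute)
  qed
  ultimately have "pi\<^sup>2 / 6 \<le> s (Suc (n - 1)) + 1 / real (Suc (n - 1))"
    using decseq_ge[of "\<lambda>n. s (Suc n) + 1 / real (Suc n)" "pi\<^sup>2 / 6" "n - 1"] by simp
  then show ?thesis using assms 1 by (simp add: s_def)
qed

text \<open>The model case \<open>f n = n^2\<close>, used to subtract the main term. Removing the
  floors costs at most \<open>4 n^(7/4)\<close>, and cutting off the series for
  \<open>\<zeta>(2)\<close> costs at most \<open>n\<close>.\<close>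

lemma sum_div_squares:
  "\<bar>(\<Sum>d=1..n. (real (n div d))\<^sup>2) - pi\<^sup>2 / 6 * (real n)\<^sup>2\<bar> \<le> 5 * real n powr (7/4)"
proof (cases "n = 0")
  case False
  then have n: "n \<ge> 1" by simp
  have le_powr: "x \<le> x powr (7/4)" if "x \<ge> 1" for x :: real
    using powr_mono[of 1 "7/4" x] that by simp
  \<comment> \<open>The natural bound is \<open>2n/d\<close>; weakening it to the power
    \<open>7/4\<close> makes the sum over \<open>d\<close> converge, so no logarithm arises.\<close>
  have sqdiff: "(real n / real d)\<^sup>2 - (real (n div d))\<^sup>2 \<in> {0..2 * (real d powr (-7/4) * real n powr (7/4))}"
    if d: "d \<in> {1..n}" for d
  proof -
    define x y where "x = real n / real d" and "y = real (n div d)"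
    have "real (n mod d) / real d \<le> 1" using d by (simp add: less_imp_le)
    then have y: "0 \<le> y" "y \<le> x" "x - y \<le> 1"
      using of_nat_of_nat_div_aux[of n d, where ?'a = real] by (simp_all add: x_def y_def)
    have x: "x \<ge> 1" using d by (simp add: x_def)
    have "x\<^sup>2 - y\<^sup>2 = (x - y) * (x + y)" by (simp add: power2_eq_square algebra_simps)
    also have "\<dots> \<le> 1 * (x + x)" using y by (intro mult_mono) auto
    also have "\<dots> \<le> 2 * x powr (7/4)" using le_powr[OF x] by simp
    also have "x powr (7/4) = real d powr (-7/4) * real n powr (7/4)"
      using d by (simp add: x_def powr_divide powr_minus field_simps)
    finally have "x\<^sup>2 - y\<^sup>2 \<le> 2 * (real d powr (-7/4) * real n powr (7/4))" .
    moreover have "y\<^sup>2 \<le> x\<^sup>2" using y by (intro power_mono) auto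
    ultimately show ?thesis by (simp add: x_def y_def)
  qed
  define D where "D = (\<Sum>d=1..n. (real n / real d)\<^sup>2 - (real (n div d))\<^sup>2)"
  have D0: "D \<ge> 0" unfolding D_def using sqdiff by (intro sum_nonneg) auto
  have "D \<le> (\<Sum>d=1..n. 2 * (real d powr (-7/4) * real n powr (7/4)))"
    unfolding D_def using sqdiff by (intro sum_mono) auto
  also have "\<dots> = 2 * (\<Sum>d=1..n. real d powr (-7/4)) * real n powr (7/4)"
    by (simp add: sum_distrib_left sum_distrib_right mult.assoc)
  also have "(\<Sum>d=1..n. real d powr (-7/4)) = 1 + (\<Sum>d=2..n. real d powr (-7/4))"
    using n by (simp add: sum.atLeast_Suc_atMost numeral_2_eq_2)
  also have "2 * (1 + (\<Sum>d=2..n. real d powr (-7/4))) * real n powr (7/4) \<le> 2 * (1 + 1) * real n powr (7/4)"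
    using sum_powr_tail_le[of n] zeta_bound_less_1 by (intro mult_right_mono mult_left_mono add_mono) auto
  finally have D1: "D \<le> 4 * real n powr (7/4)" by simp
  define s where "s = (\<Sum>d=1..n. 1 / (real d)\<^sup>2)"
  have "D = (real n)\<^sup>2 * s - (\<Sum>d=1..n. (real (n div d))\<^sup>2)"
    by (simp add: D_def s_def sum_subtractf sum_distrib_left power_divide)
  moreover have "(real n)\<^sup>2 * s \<le> (real n)\<^sup>2 * (pi\<^sup>2 / 6)"
    using inverse_squares_partial_sum[OF n] by (intro mult_left_mono) (auto simp: s_def)
  moreover have "(real n)\<^sup>2 * (pi\<^sup>2 / 6 - 1 / real n) \<le> (real n)\<^sup>2 * s"
    using inverse_squares_partial_sum[OF n] by (intro mult_left_mono) (auto simp: s_def)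
  moreover have "(real n)\<^sup>2 * (pi\<^sup>2 / 6 - 1 / real n) = pi\<^sup>2 / 6 * (real n)\<^sup>2 - real n"
    using n by (simp add: field_simps power2_eq_square)
  moreover have "real n \<le> real n powr (7/4)" using n by (intro le_powr) auto
  ultimately show ?thesis using D0 D1 by (simp add: abs_le_iff algebra_simps)
qed auto

text \<open>The bound propagates by strong induction because the terms with \<open>d > 1\<close>
  contribute a factor at most \<open>\<zeta>(7/4) - 1 < 1\<close>; no Moebius inversion is needed.\<close>

lemma count_asymptotic_of_divisor_sum:
  fixes f :: "nat \<Rightarrow> real"
  assumes f: "\<And>n. \<bar>(\<Sum>d=1..n. f (n div d)) - a * (real n)\<^sup>2\<bar> \<le> K * real n powr (7/4)"
    and f0: "f 0 = 0"
  shows "\<exists>C. \<forall>n. \<bar>f n - 6 * a / pi\<^sup>2 * (real n)\<^sup>2\<bar> \<le> C * real n powr (7/4)"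
proof -
  define c where "c = 6 * a / pi\<^sup>2"
  define E where "E n = f n - c * (real n)\<^sup>2" for n
  define R where "R = K + 5 * \<bar>c\<bar>"
  \<comment> \<open>The fixed point of \<open>C = R + C * zeta_bound\<close>, which closes the
    induction below.\<close>
  define C where "C = R / (1 - zeta_bound)"
  \<comment> \<open>By the choice of \<open>c\<close>, the quadratic terms cancel in the floor sum
    of \<open>E\<close>.\<close>
  have sumE: "\<bar>\<Sum>d=1..n. E (n div d)\<bar> \<le> R * real n powr (7/4)" for n
  proof -
    define s where "s = (\<Sum>d=1..n. (real (n div d))\<^sup>2)"
    have a: "a = c * (pi\<^sup>2 / 6)" by (simp add: c_def)
    have "(\<Sum>d=1..n. E (n div d)) = ((\<Sum>d=1..n. f (n div d)) - a * (real n)\<^sup>2) - c * (s - pi\<^sup>2 / 6 * (real n)\<^sup>2)"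
      by (simp add: E_def s_def sum_subtractf sum_distrib_left a algebra_simps)
    also have "\<bar>\<dots>\<bar> \<le> K * real n powr (7/4) + \<bar>c\<bar> * (5 * real n powr (7/4))"
      using f[of n] mult_left_mono[OF sum_div_squares[of n], of "\<bar>c\<bar>"]
      unfolding s_def by (simp only: flip: abs_mult) linarith
    finally show ?thesis by (simp add: R_def algebra_simps)
  qed
  have "0 \<le> K" using f[of 1] by (simp add: abs_le_iff)
  then have C: "C \<ge> 0" using zeta_bound_less_1 by (simp add: C_def R_def)
  have RC: "R + C * zeta_bound = C" using zeta_bound_less_1 by (simp add: C_def field_simps)
  have "\<bar>E n\<bar> \<le> C * real n powr (7/4)" for n
  proof (induction n rule: less_induct)
    case (less n)
    show ?case
    proof (cases "n = 0")
      case False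
      have "(\<Sum>d=1..n. E (n div d)) = E n + (\<Sum>d=2..n. E (n div d))"
        using False by (simp add: sum.atLeast_Suc_atMost numeral_2_eq_2)
      then have "\<bar>E n\<bar> \<le> R * real n powr (7/4) + \<bar>\<Sum>d=2..n. E (n div d)\<bar>"
        using sumE[of n] by linarith
      also have "\<bar>\<Sum>d=2..n. E (n div d)\<bar> \<le> (\<Sum>d=2..n. \<bar>E (n div d)\<bar>)" by (rule sum_abs)
      also have "\<dots> \<le> (\<Sum>d=2..n. C * real (n div d) powr (7/4))"
        using less False by (intro sum_mono) auto
      also have "\<dots> \<le> C * (zeta_bound * real n powr (7/4))"
        using mult_left_mono[OF sum_powr_div_le[of n] C] by (simp add: sum_distrib_left)
      also have "R * real n powr (7/4) + \<dots> = C * real n powr (7/4)"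
        using RC by (metis (no_types, lifting) distrib_right mult.assoc)
      finally show ?thesis by simp
    qed (simp add: E_def f0)
  qed
  then show ?thesis by (auto simp: E_def c_def)
qed

subsection \<open>Farey neighbours and mediants\<close>

text \<open>Pairs instead of rationals, because mediants and determinants depend on numerator and
  denominator and not only on the value.\<close>

type_synonym fraction = "int \<times> int"

definition frac_value :: "fraction \<Rightarrow> real" where
  "frac_value x = of_int (fst x) / of_int (snd x)"

definition mediant :: "fraction \<Rightarrow> fraction \<Rightarrow> fraction" where
  "mediant x y = (fst x + fst y, snd x + snd y)"

definition farey_fracs :: "nat \<Rightarrow> fraction set" where
  "farey_fracs Q = {(p, q). 0 \<le> p \<and> p \<le> q \<and> 1 \<le> q \<and> q \<le> int Q \<and> coprime p q}"

text \<open>Consecutiveness in algebraic form: determinant 1, and a denominator sum exceeding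
  \<open>Q\<close>, so that the mediant is not yet present.
  \<open>farey_neighbours_no_between\<close> and \<open>ex_farey_successor\<close> connect this with
  the order.\<close>

definition farey_neighbours :: "nat \<Rightarrow> (fraction \<times> fraction) set" where
  "farey_neighbours Q = {((p, q), (r, s)). 0 \<le> p \<and> r \<le> s \<and> 1 \<le> q \<and> q \<le> int Q \<and> 1 \<le> s \<and> s \<le> int Q
     \<and> int Q < q + s \<and> r * q - p * s = 1}"

lemma coprime_if_det_1:
  fixes p q r s :: int
  assumes "r * q - p * s = 1"
  shows "coprime p q" "coprime r s"
proof -
  have "k dvd r * q - p * s" if "k dvd p \<and> k dvd q \<or> k dvd r \<and> k dvd s" for k
    using that by (auto intro!: dvd_diff)
  then show "coprime p q" "coprime r s" using assms by (auto intro!: coprimeI)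
qed

lemma finite_farey_fracs: "finite (farey_fracs Q)"
proof (rule finite_subset)
  show "farey_fracs Q \<subseteq> {0..int Q} \<times> {0..int Q}" by (auto simp: farey_fracs_def)
qed auto

lemma farey_neighbours_subset: "farey_neighbours Q \<subseteq> farey_fracs Q \<times> farey_fracs Q"
proof -
  have *: "p \<le> q \<and> 0 \<le> r \<and> coprime p q \<and> coprime r s"
    if "0 \<le> p" "r \<le> s" "1 \<le> q" "1 \<le> s" "r * q - p * s = 1" for p q r s :: int
  proof (intro conjI)
    have "p * s < r * q" using that by simp
    also have "\<dots> \<le> s * q" using that by (intro mult_right_mono) auto
    finally show "p \<le> q" using that by (simp add: mult.commute)
    have "0 \<le> p * s" using that by simp
    then have "0 < r * q" using that by linarith
    then show "0 \<le> r" using that by (simp add: zero_less_mult_iff)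
  qed (use coprime_if_det_1[OF that(5)] in auto)
  show ?thesis
  proof clarify
    fix p q r s assume pqrs: "((p, q), (r, s)) \<in> farey_neighbours Q"
    then have "p \<le> q \<and> 0 \<le> r \<and> coprime p q \<and> coprime r s"
      by (intro *) (simp_all add: farey_neighbours_def)
    with pqrs show "(p, q) \<in> farey_fracs Q \<and> (r, s) \<in> farey_fracs Q"
      by (simp add: farey_neighbours_def farey_fracs_def)
  qed
qed

lemma finite_farey_neighbours: "finite (farey_neighbours Q)"
  by (rule finite_subset[OF farey_neighbours_subset]) (simp add: finite_farey_fracs)

lemma frac_value_less_iff:
  "snd x > 0 \<Longrightarrow> snd y > 0 \<Longrightarrow> frac_value x < frac_value y \<longleftrightarrow> fst x * snd y < fst y * snd x"
  unfolding frac_value_def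
  by (simp add: divide_simps mult.commute flip: of_int_mult)

lemma frac_value_inj_on_farey_fracs: "inj_on frac_value (farey_fracs Q)"
proof (rule inj_onI)
  fix x y assume xy: "x \<in> farey_fracs Q" "y \<in> farey_fracs Q" "frac_value x = frac_value y"
  obtain p q r s where [simp]: "x = (p, q)" "y = (r, s)" by fastforce
  have "of_int p / of_int q = (of_int r / of_int s :: real)" using xy by (simp add: frac_value_def)
  then have eq: "p * s = r * q" using xy
    by (auto simp: farey_fracs_def divide_simps simp flip: of_int_mult)
  have cop: "coprime p q" "coprime r s" "q > 0" "s > 0" using xy by (auto simp: farey_fracs_def)
  have "q dvd s" using cop(1) eq by (metis coprime_commute coprime_dvd_mult_right_iff dvd_triv_right)
  moreover have "s dvd q" using cop(2) eq by (metis coprime_commute coprime_dvd_mult_right_iff dvd_triv_right)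
  ultimately have "q = s" using cop by (simp add: zdvd_antisym_nonneg)
  then show "x = y" using eq cop by simp
qed

lemma farey_neighbours_less:
  "(x, y) \<in> farey_neighbours Q \<Longrightarrow> frac_value x < frac_value y"
  by (subst frac_value_less_iff) (auto simp: farey_neighbours_def)

text \<open>The determinant identity expresses \<open>v\<close> as a combination of \<open>q\<close>
  and \<open>s\<close> whose coefficients are positive integers when \<open>u/v\<close> lies
  strictly between the two fractions.\<close>

lemma denominator_between:
  fixes p q r s u v :: int
  assumes "r * q - p * s = 1" "q > 0" "s > 0" "p * v < u * q" "u * s < r * v"
  shows "q + s \<le> v"
proof -
  have "v = v * (r * q - p * s)" using assms by simp
  also have "\<dots> = q * (r * v - u * s) + s * (u * q - p * v)" by (simp add: algebra_simps)
  also have "\<dots> \<ge> q * 1 + s * 1" using assms by (intro add_mono mult_left_mono) auto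
  finally show ?thesis by simp
qed

lemma farey_neighbours_no_between:
  assumes "(x, y) \<in> farey_neighbours Q" "z \<in> farey_fracs Q" "frac_value x < frac_value z"
  shows "frac_value y \<le> frac_value z"
proof (rule ccontr)
  assume "\<not> ?thesis"
  then have "frac_value z < frac_value y" by simp
  then have "snd x + snd y \<le> snd z"
    using assms denominator_between[of "fst y" "snd x" "fst x" "snd y" "snd z" "fst z"]
    by (simp add: frac_value_less_iff farey_neighbours_def farey_fracs_def split: prod.splits)
  then show False using assms by (auto simp: farey_neighbours_def farey_fracs_def)
qed

text \<open>Intervals between neighbours overlap at most in endpoints. \<open>strict\<close>
  excludes a shared endpoint; its alternatives treat the intervals as half-open on the left or on
  the right, as required at \<alpha> and \<beta> respectively.\<close>

lemma farey_neighbours_disjoint: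
  assumes xy: "(x, y) \<in> farey_neighbours Q" "(x', y') \<in> farey_neighbours Q"
    and a: "frac_value x \<le> a" "a \<le> frac_value y" "frac_value x' \<le> a" "a \<le> frac_value y'"
    and strict: "(frac_value x < a \<and> frac_value x' < a) \<or> (a < frac_value y \<and> a < frac_value y')"
  shows "x = x'" "y = y'"
proof -
  have mem: "x \<in> farey_fracs Q" "y \<in> farey_fracs Q" "x' \<in> farey_fracs Q" "y' \<in> farey_fracs Q"
    using subsetD[OF farey_neighbours_subset xy(1)] subsetD[OF farey_neighbours_subset xy(2)] by simp_all
  have "\<not> frac_value x < frac_value x'" "\<not> frac_value x' < frac_value x"
    using farey_neighbours_no_between[OF xy(1) mem(3)] farey_neighbours_no_between[OF xy(2) mem(1)]
      a strict by auto
  then show "x = x'" using frac_value_inj_on_farey_fracs mem by (metis inj_onD linorder_neqE)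
  then have "frac_value y = frac_value y'"
    using farey_neighbours_no_between[OF xy(1) mem(4)] farey_neighbours_no_between[OF xy(2) mem(2)]
      farey_neighbours_less xy by (metis order_antisym)
  then show "y = y'" using frac_value_inj_on_farey_fracs mem by (metis inj_onD)
qed

text \<open>The admissible \<open>s\<close> form a residue class mod \<open>q\<close>, so each
  window of length \<open>q\<close> contains one.\<close>

lemma ex_det_1_int:
  fixes p q N :: int
  assumes "coprime p q" "q > 0"
  shows "\<exists>r s. r * q - p * s = 1 \<and> N - q < s \<and> s \<le> N"
proof -
  obtain u v where uv: "u * p + v * q = 1"
    using bezout_int[of p q] assms(1) unfolding coprime_iff_gcd_eq_1 by metis
  define k where "k = (N + u) div q"
  have "v * q + k * p * q - p * (k * q - u) = 1" using uv by (simp add: algebra_simps)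
  then have "(v + k * p) * q - p * (k * q - u) = 1" by (simp add: algebra_simps)
  moreover have "N - q < k * q - u \<and> k * q - u \<le> N"
    using div_mult_mod_eq[of "N + u" q] pos_mod_sign[of q "N + u"] pos_mod_bound[of q "N + u"] assms
    unfolding k_def by linarith
  ultimately show ?thesis by blast
qed

lemma ex_farey_successor:
  assumes "x \<in> farey_fracs Q" "fst x < snd x"
  shows "\<exists>y. (x, y) \<in> farey_neighbours Q"
proof -
  obtain p q where [simp]: "x = (p, q)" by fastforce
  have pq: "0 \<le> p" "p < q" "1 \<le> q" "q \<le> int Q" "coprime p q"
    using assms by (auto simp: farey_fracs_def)
  obtain r s where rs: "r * q - p * s = 1" "int Q - q < s" "s \<le> int Q"
    using ex_det_1_int[of p q "int Q"] pq by auto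
  \<comment> \<open>Otherwise the determinant would be at least
    \<open>(s + 1) q - (q - 1) s = q + s\<close>, which exceeds 1.\<close>
  have "r \<le> s"
  proof (rule ccontr)
    assume "\<not> ?thesis"
    then have "(s + 1) * q \<le> r * q" using pq by (intro mult_right_mono) auto
    moreover have "p * s \<le> (q - 1) * s" using pq rs by (intro mult_right_mono) auto
    ultimately show False using rs pq by (simp add: algebra_simps)
  qed
  then have "(x, (r, s)) \<in> farey_neighbours Q" using pq rs by (auto simp: farey_neighbours_def)
  then show ?thesis ..
qed

text \<open>Injectivity holds because a mediant lies strictly inside the interval of its parents.
  For surjectivity, Bezout gives the left parent of a new fraction, and componentwise subtraction
  gives the right one.\<close>

lemma bij_betw_mediant:
  assumes "Q \<ge> 1"
  shows "bij_betw (\<lambda>(x, y). mediant x y) {(x, y) \<in> farey_neighbours Q. snd x + snd y = int Q + 1}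
           (farey_fracs (Suc Q) - farey_fracs Q)" (is "bij_betw ?m ?D ?B")
proof (rule bij_betw_imageI)
  have between: "frac_value x < frac_value (mediant x y)" "frac_value (mediant x y) < frac_value y"
    if "(x, y) \<in> ?D" for x y
  proof -
    have "snd x > 0" "snd y > 0" "fst y * snd x - fst x * snd y = 1"
      using that by (auto simp: farey_neighbours_def)
    then show "frac_value x < frac_value (mediant x y)" "frac_value (mediant x y) < frac_value y"
      by (simp_all add: frac_value_less_iff mediant_def algebra_simps)
  qed
  show "inj_on ?m ?D"
  proof (rule inj_onI)
    fix e e' assume e: "e \<in> ?D" "e' \<in> ?D" "?m e = ?m e'"
    obtain x y x' y' where [simp]: "e = (x, y)" "e' = (x', y')" by (metis surj_pair)
    have "x = x' \<and> y = y'"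
      using farey_neighbours_disjoint[of x y Q x' y' "frac_value (mediant x y)"]
        between[of x y] between[of x' y'] e by simp
    then show "e = e'" by simp
  qed
  show "?m ` ?D = ?B"
  proof (intro equalityI subsetI)
    fix z assume "z \<in> ?m ` ?D"
    then obtain p q r s where *: "((p, q), (r, s)) \<in> ?D" "z = (p + r, q + s)"
      by (auto simp: mediant_def)
    have "r * q - p * s = 1" using *(1) by (simp add: farey_neighbours_def)
    then have "(p + r) * q - p * (q + s) = 1" by (simp add: algebra_simps)
    then have "coprime (p + r) (q + s)" by (rule coprime_if_det_1)
    then show "z \<in> ?B" using * farey_neighbours_subset[of Q] by (auto simp: farey_fracs_def)
  next
    fix z assume z: "z \<in> ?B"
    obtain a b where [simp]: "z = (a, b)" by fastforce
    have b: "b = int Q + 1" and a: "0 \<le> a" "a \<le> b" and cop: "coprime a b"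
      using z by (auto simp: farey_fracs_def)
    \<comment> \<open>The existence lemma is applied to \<open>-a\<close> to reverse the sign of the
      determinant, with the window \<open>{0..b - 1}\<close> for \<open>q\<close>.\<close>
    obtain p q where pq: "p * b - a * q = - 1" "0 \<le> q" "q < b"
    proof -
      have "coprime (- a) b" using cop by simp
      then obtain p q where "p * b - (- a) * q = 1" "b - 1 - b < q" "q \<le> b - 1"
        using ex_det_1_int[of "- a" b "b - 1"] b by auto
      then show ?thesis using that[of "- p" q] by (simp add: algebra_simps)
    qed
    have q: "q \<ge> 1"
    proof (rule ccontr)
      assume "\<not> ?thesis"
      then have "q = 0" using pq by simp
      then have "p * b = - 1" using pq by simp
      then have "b dvd 1" by (metis dvd_minus_iff dvd_triv_right)
      then show False using b assms by simp
    qed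
    have "a \<noteq> b"
    proof
      assume "a = b"
      then have "is_unit b" using cop by simp
      then show False using b assms by simp
    qed
    moreover have "a \<noteq> 0" 
    proof
      assume "a = 0"
      then have "is_unit b" using cop by simp
      then show False using b assms by simp
    qed
    ultimately have a: "1 \<le> a" "a \<le> b - 1" using a by auto
    have p: "0 \<le> p"
    proof -
      have "1 * 1 \<le> a * q" using a q by (intro mult_mono) auto
      then have "0 \<le> p * b" using pq by simp
      then show ?thesis using b by (simp add: zero_le_mult_iff)
    qed
    have det: "(a - p) * b - a * (b - q) = 1" using pq by (simp add: algebra_simps)
    have "a - p \<le> b - q"
    proof (rule ccontr)
      assume "\<not> ?thesis"
      then have "(b - q + 1) * b \<le> (a - p) * b" using b by (intro mult_right_mono) auto
      moreover have "a * (b - q) \<le> (b - 1) * (b - q)" using a pq by (intro mult_right_mono) auto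
      ultimately have "(b - q + 1) * b \<le> 1 + (b - 1) * (b - q)" using det by linarith
      then have "b + (b - q) \<le> 1" by (simp add: algebra_simps)
      then show False using pq(3) b by linarith
    qed
    moreover have "(a - p) * q - p * (b - q) = 1" using pq by (simp add: algebra_simps)
    ultimately have "((p, q), (a - p, b - q)) \<in> ?D"
      using p q pq(3) unfolding b farey_neighbours_def by simp
    then show "z \<in> ?m ` ?D" by (rule rev_image_eqI) (simp add: mediant_def)
  qed
qed

text \<open>Passing to order \<open>Q + 1\<close> splits exactly the pairs with denominator sum
  \<open>Q + 1\<close> at their mediant. Conversely, in a pair having one denominator
  \<open>Q + 1\<close>, subtracting the old fraction from the new one recovers the other parent; two
  such denominators would force \<open>Q + 1\<close> to divide 1.\<close>

lemma farey_neighbours_Suc: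
  assumes "Q \<ge> 1"
  defines "D \<equiv> {(x, y) \<in> farey_neighbours Q. snd x + snd y = int Q + 1}"
  shows "farey_neighbours (Suc Q) = (farey_neighbours Q - D)
           \<union> ((\<lambda>(x, y). (x, mediant x y)) ` D \<union> (\<lambda>(x, y). (mediant x y, y)) ` D)"
    (is "_ = _ \<union> (?L ` D \<union> ?R ` D)")
proof (intro equalityI subsetI)
  fix e assume e: "e \<in> farey_neighbours (Suc Q)"
  obtain p q r s where [simp]: "e = ((p, q), (r, s))" by (metis surj_pair)
  have *: "0 \<le> p" "r \<le> s" "1 \<le> q" "q \<le> int Q + 1" "1 \<le> s" "s \<le> int Q + 1"
    "int Q + 1 < q + s" "r * q - p * s = 1"
    using e by (simp_all add: farey_neighbours_def)
  have "0 \<le> p * s" using * by simp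
  then have "0 < r * q" using * by linarith
  then have r: "1 \<le> r" using * by (simp add: zero_less_mult_iff)
  have "p * s < r * q" using * by simp
  also have "\<dots> \<le> s * q" using * by (intro mult_right_mono) auto
  finally have p: "p < q" using * by (simp add: mult.commute)
  consider "q = int Q + 1" "s = int Q + 1" | "q = int Q + 1" "s \<le> int Q" | "q \<le> int Q" "s = int Q + 1"
    | "q \<le> int Q" "s \<le> int Q" using * by linarith
  then show "e \<in> (farey_neighbours Q - D) \<union> (?L ` D \<union> ?R ` D)"
  proof cases
    case 1
    then have "(r - p) * (int Q + 1) = 1" using * by (simp add: algebra_simps)
    then have "int Q + 1 dvd 1" by (metis dvd_triv_right)
    then show ?thesis using assms by simp
  next
    case 2
    \<comment> \<open>By the determinant, \<open>(p - r) s = r (q - s) - 1\<close>; this gives the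
      parent a nonnegative numerator.\<close>
    have "1 * 1 \<le> r * (q - s)" using r 2 by (intro mult_mono) auto
    then have "0 \<le> (p - r) * s" using * by (simp add: algebra_simps)
    then have "0 \<le> p - r" using * by (simp add: zero_le_mult_iff)
    then have "((p - r, q - s), (r, s)) \<in> D"
      using * 2 by (simp add: D_def farey_neighbours_def algebra_simps)
    moreover have "e = ?R ((p - r, q - s), (r, s))" by (simp add: mediant_def)
    ultimately show ?thesis by blast
  next
    case 3
    have "1 * 1 \<le> (q - p) * (s - q)" using p 3 by (intro mult_mono) auto
    then have "0 \<le> q * ((s - q) - (r - p))" using * by (simp add: algebra_simps)
    then have "r - p \<le> s - q" using * by (simp add: zero_le_mult_iff)
    then have "((p, q), (r - p, s - q)) \<in> D"
      using * 3 by (simp add: D_def farey_neighbours_def algebra_simps)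
    moreover have "e = ?L ((p, q), (r - p, s - q))" by (simp add: mediant_def)
    ultimately show ?thesis by blast
  next
    case 4
    then show ?thesis using * by (simp add: D_def farey_neighbours_def)
  qed
next
  have new: "?L d \<in> farey_neighbours (Suc Q) \<and> ?R d \<in> farey_neighbours (Suc Q)" if "d \<in> D" for d
  proof -
    obtain p q r s where [simp]: "d = ((p, q), (r, s))" by (metis surj_pair)
    have d: "((p, q), (r, s)) \<in> farey_neighbours Q" and Q: "q + s = int Q + 1"
      using that by (simp_all add: D_def)
    have "p \<le> q" "0 \<le> r"
      using subsetD[OF farey_neighbours_subset d] by (simp_all add: farey_fracs_def)
    moreover have *: "0 \<le> p" "r \<le> s" "1 \<le> q" "1 \<le> s" "r * q - p * s = 1"
      using d by (simp_all add: farey_neighbours_def)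
    moreover have "(p + r) * q - p * (q + s) = 1" "r * (q + s) - (p + r) * s = 1"
      using *(5) by (simp_all add: algebra_simps)
    moreover have "p + r \<le> q + s" using \<open>p \<le> q\<close> \<open>r \<le> s\<close> by simp
    ultimately show ?thesis using Q by (simp add: farey_neighbours_def mediant_def)
  qed
  fix e assume "e \<in> (farey_neighbours Q - D) \<union> (?L ` D \<union> ?R ` D)"
  then consider "e \<in> farey_neighbours Q - D" | d where "d \<in> D" "e = ?L d" | d where "d \<in> D" "e = ?R d"
    by blast
  then show "e \<in> farey_neighbours (Suc Q)"
  proof cases
    case 1
    then show ?thesis by (auto simp: D_def farey_neighbours_def)
  next
    case 2
    then show ?thesis using new by blast
  next
    case 3
    then show ?thesis using new by blast
  qed
qed

text \<open>The positions of the denominator \<open>Q + 1\<close> separate the three kinds of pairs: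
  none, second place, first place.\<close>

lemma sum_farey_neighbours_Suc:
  fixes f :: "fraction \<times> fraction \<Rightarrow> real"
  assumes Q: "Q \<ge> 1"
  defines "D \<equiv> {(x, y) \<in> farey_neighbours Q. snd x + snd y = int Q + 1}"
  shows "sum f (farey_neighbours (Suc Q)) =
    sum f (farey_neighbours Q) + (\<Sum>(x, y)\<in>D. f (x, mediant x y) + f (mediant x y, y) - f (x, y))"
proof -
  let ?L = "\<lambda>(x, y). (x, mediant x y)" and ?R = "\<lambda>(x, y). (mediant x y, y)"
  have D: "D \<subseteq> farey_neighbours Q" by (auto simp: D_def)
  have fin: "finite D" using D finite_farey_neighbours by (rule finite_subset)
  have den: "snd x \<le> int Q" "snd y \<le> int Q" if "(x, y) \<in> farey_neighbours Q" for x y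
    using that by (auto simp: farey_neighbours_def)
  have denD: "snd (mediant x y) = int Q + 1" if "(x, y) \<in> D" for x y
    using that by (auto simp: D_def mediant_def)
  have base: "snd (fst e) \<le> int Q \<and> snd (snd e) \<le> int Q" if "e \<in> farey_neighbours Q" for e
    using den[of "fst e" "snd e"] that by simp
  have left: "snd (fst e) \<le> int Q \<and> snd (snd e) = int Q + 1" if "e \<in> ?L ` D" for e
    using that denD den D by auto
  have right: "snd (fst e) = int Q + 1" if "e \<in> ?R ` D" for e
    using that denD by auto
  have disj: "(farey_neighbours Q - D) \<inter> (?L ` D \<union> ?R ` D) = {}" "?L ` D \<inter> ?R ` D = {}"
  proof -
    have "e \<notin> farey_neighbours Q" if "e \<in> ?L ` D" for e using left[OF that] base[of e] by linarith
    moreover have "e \<notin> farey_neighbours Q" if "e \<in> ?R ` D" for e using right[OF that] base[of e] by linarith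
    moreover have "e \<notin> ?R ` D" if "e \<in> ?L ` D" for e using left[OF that] right[of e] by linarith
    ultimately show "(farey_neighbours Q - D) \<inter> (?L ` D \<union> ?R ` D) = {}" "?L ` D \<inter> ?R ` D = {}"
      by blast+
  qed
  have inj: "inj_on ?L D" "inj_on ?R D" by (auto simp: inj_on_def mediant_def prod_eq_iff)
  have "sum f (farey_neighbours (Suc Q)) = sum f (farey_neighbours Q - D) + (sum f (?L ` D) + sum f (?R ` D))"
    unfolding farey_neighbours_Suc[OF Q, folded D_def] using disj fin finite_farey_neighbours[of Q]
    by (simp add: sum.union_disjoint)
  also have "sum f (farey_neighbours Q - D) = sum f (farey_neighbours Q) - sum f D"
    using D finite_farey_neighbours by (intro sum_diff)
  finally show ?thesis using inj
    by (simp add: sum.reindex case_prod_unfold sum.distrib sum_subtractf)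
qed

subsection \<open>Index sums\<close>

definition den_ratio :: "fraction \<Rightarrow> fraction \<Rightarrow> real" where
  "den_ratio x y = of_int (snd x) / of_int (snd y)"

text \<open>Summed over all neighbours, this is the sum over \<open>x\<close> of \<open>w x\<close> times the index of \<open>x\<close>
  (the sum of the denominators of the two neighbours of \<open>x\<close> divided by its own), except that
  0 and 1 have a single neighbour.\<close>

definition edge_weight :: "(fraction \<Rightarrow> real) \<Rightarrow> fraction \<times> fraction \<Rightarrow> real" where
  "edge_weight w e = (case e of (x, y) \<Rightarrow> w x * (den_ratio y x) + w y * (den_ratio x y))"

lemma edge_weight_mediant:
  assumes "snd x > 0" "snd y > 0"
  shows "edge_weight w (x, mediant x y) + edge_weight w (mediant x y, y) - edge_weight w (x, y)
    = w x + w y + w (mediant x y)"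
proof -
  have "w m * (a / (a + b)) + w m * (b / (a + b)) = w m" if "a > 0" "b > 0" for m and a b :: real
    using that by (simp flip: distrib_left add_divide_distrib)
  from this[of "snd x" "snd y" "mediant x y"] assms
  show ?thesis by (simp add: edge_weight_def den_ratio_def mediant_def add_divide_distrib distrib_left)
qed

text \<open>Subtracting three times the total weight cancels everything except the variation of
  \<open>w\<close> between a mediant and its parents, which vanishes wherever \<open>w\<close> is
  locally constant.\<close>

lemma sum_edge_weight_Suc:
  assumes Q: "Q \<ge> 1"
  defines "D \<equiv> {(x, y) \<in> farey_neighbours Q. snd x + snd y = int Q + 1}"
  shows "sum (edge_weight w) (farey_neighbours (Suc Q)) - 3 * sum w (farey_fracs (Suc Q))
    = sum (edge_weight w) (farey_neighbours Q) - 3 * sum w (farey_fracs Q)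
      + (\<Sum>(x, y)\<in>D. w x + w y - 2 * w (mediant x y))"
proof -
  have sub: "farey_fracs Q \<subseteq> farey_fracs (Suc Q)" by (auto simp: farey_fracs_def)
  have "sum w (farey_fracs (Suc Q)) - sum w (farey_fracs Q) = sum w (farey_fracs (Suc Q) - farey_fracs Q)"
    using sum_diff[OF finite_farey_fracs sub, of w] by simp
  also have "\<dots> = (\<Sum>e\<in>D. w (case e of (x, y) \<Rightarrow> mediant x y))"
    using sum.reindex_bij_betw[OF bij_betw_mediant[OF Q], of w] by (simp add: D_def)
  finally have W: "sum w (farey_fracs (Suc Q)) - sum w (farey_fracs Q) = (\<Sum>(x, y)\<in>D. w (mediant x y))"
    by (simp add: case_prod_unfold)
  have "sum (edge_weight w) (farey_neighbours (Suc Q)) - sum (edge_weight w) (farey_neighbours Q)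
    = (\<Sum>(x, y)\<in>D. edge_weight w (x, mediant x y) + edge_weight w (mediant x y, y) - edge_weight w (x, y))"
    using sum_farey_neighbours_Suc[OF Q, of "edge_weight w"] by (simp add: D_def)
  also have "\<dots> = (\<Sum>(x, y)\<in>D. w x + w y + w (mediant x y))"
    by (intro sum.cong refl) (auto simp: D_def farey_neighbours_def edge_weight_mediant)
  also have "\<dots> = (\<Sum>(x, y)\<in>D. w x + w y - 2 * w (mediant x y)) + 3 * (\<Sum>(x, y)\<in>D. w (mediant x y))"
    by (simp add: case_prod_unfold sum_distrib_left algebra_simps flip: sum.distrib)
  finally show ?thesis using W by linarith
qed

text \<open>For any other neighbour pair, both fractions and all points between them lie inside
  \<open>[\<alpha>, \<beta>]\<close>, or all lie outside. The half-open conditions match a closed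
  interval.\<close>

definition crossing_neighbours :: "nat \<Rightarrow> real \<Rightarrow> real \<Rightarrow> (fraction \<times> fraction) set" where
  "crossing_neighbours Q \<alpha> \<beta> = {(x, y) \<in> farey_neighbours Q.
     (frac_value x < \<alpha> \<and> \<alpha> \<le> frac_value y) \<or> (frac_value x \<le> \<beta> \<and> \<beta> < frac_value y)}"

lemma card_crossing_neighbours: "card (crossing_neighbours Q \<alpha> \<beta>) \<le> 2"
proof -
  define L where "L = {(x, y) \<in> farey_neighbours Q. frac_value x < \<alpha> \<and> \<alpha> \<le> frac_value y}"
  define R where "R = {(x, y) \<in> farey_neighbours Q. frac_value x \<le> \<beta> \<and> \<beta> < frac_value y}"
  have fin: "finite L" "finite R"
    by (auto intro!: finite_subset[OF _ finite_farey_neighbours[of Q]] simp: L_def R_def)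
  have "e = e'" if "e \<in> L" "e' \<in> L" for e e'
    using that farey_neighbours_disjoint[of "fst e" "snd e" Q "fst e'" "snd e'" \<alpha>]
    by (simp add: L_def case_prod_unfold prod_eq_iff)
  then have "card L \<le> 1" using card_le_Suc0_iff_eq[OF fin(1)] by simp
  moreover have "e = e'" if "e \<in> R" "e' \<in> R" for e e'
    using that farey_neighbours_disjoint[of "fst e" "snd e" Q "fst e'" "snd e'" \<beta>]
    by (simp add: R_def case_prod_unfold prod_eq_iff)
  then have "card R \<le> 1" using card_le_Suc0_iff_eq[OF fin(2)] by simp
  moreover have "crossing_neighbours Q \<alpha> \<beta> = L \<union> R" by (auto simp: crossing_neighbours_def L_def R_def)
  ultimately show ?thesis using card_Un_le[of L R] by simp
qed

text \<open>Used twice: with \<open>B = 2\<close> for the defect in the mediant recursion, and with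
  \<open>B = Q\<close> for the boundary terms of the index sum.\<close>

lemma sum_crossing_neighbours_le:
  fixes g :: "fraction \<times> fraction \<Rightarrow> real"
  assumes "A \<subseteq> farey_neighbours Q" "B \<ge> 0"
    and g: "\<And>e. e \<in> A \<Longrightarrow> \<bar>g e\<bar> \<le> B"
    and zero: "\<And>e. e \<in> A \<Longrightarrow> e \<notin> crossing_neighbours Q \<alpha> \<beta> \<Longrightarrow> g e = 0"
  shows "\<bar>sum g A\<bar> \<le> 2 * B"
proof -
  have finA: "finite A" using assms(1) finite_farey_neighbours by (rule finite_subset)
  have fin: "finite (crossing_neighbours Q \<alpha> \<beta>)"
    by (rule finite_subset[OF _ finite_farey_neighbours[of Q]]) (auto simp: crossing_neighbours_def)
  have "sum g A = sum g (A \<inter> crossing_neighbours Q \<alpha> \<beta>)"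
    using finA zero by (intro sum.mono_neutral_right) auto
  then have "\<bar>sum g A\<bar> \<le> (\<Sum>e\<in>A \<inter> crossing_neighbours Q \<alpha> \<beta>. \<bar>g e\<bar>)" using sum_abs by metis
  also have "\<dots> \<le> of_nat (card (A \<inter> crossing_neighbours Q \<alpha> \<beta>)) * B"
    using g by (intro sum_bounded_above) auto
  also have "\<dots> \<le> 2 * B"
  proof (rule mult_right_mono)
    have "card (A \<inter> crossing_neighbours Q \<alpha> \<beta>) \<le> 2"
      using card_mono[OF fin, of "A \<inter> crossing_neighbours Q \<alpha> \<beta>"] card_crossing_neighbours[of Q \<alpha> \<beta>] by auto
    then show "real (card (A \<inter> crossing_neighbours Q \<alpha> \<beta>)) \<le> 2" by linarith
  qed fact
  finally show ?thesis .
qed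

definition fracs_in :: "nat \<Rightarrow> real \<Rightarrow> real \<Rightarrow> fraction set" where
  "fracs_in Q \<alpha> \<beta> = {x \<in> farey_fracs Q. frac_value x \<in> {\<alpha>..\<beta>}}"

lemma farey_neighbours_1: "farey_neighbours 1 = {((0, 1), (1, 1))}"
proof -
  have "p = 0 \<and> q = 1 \<and> r = 1 \<and> s = 1"
    if "0 \<le> p" "r \<le> s" "q \<le> 1" "s \<le> 1" "1 < q + s" "r * q - p * s = 1" for p q r s :: int
  proof -
    have qs: "q = 1" "s = 1" using that by linarith+
    then have "r - p = 1" using that(6) by simp
    then show ?thesis using that(1,2) qs by linarith
  qed
  then show ?thesis by (auto simp: farey_neighbours_def)
qed

lemma farey_fracs_1: "farey_fracs 1 = {(0, 1), (1, 1)}"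
proof -
  have "p = 0 \<or> p = 1" if "0 \<le> p" "p \<le> 1" for p :: int using that by linarith
  then show ?thesis by (force simp: farey_fracs_def)
qed

text \<open>Each step in \<open>Q\<close> costs at most 4: two crossing pairs, each with defect at
  most 2. For \<open>Q = 1\<close> the difference is
  \<open>-2 (w (0, 1) + w (1, 1))\<close>.\<close>

lemma sum_edge_weight_indicator:
  fixes \<alpha> \<beta> :: real
  assumes "Q \<ge> 1"
  defines "w \<equiv> (\<lambda>x. of_bool (frac_value x \<in> {\<alpha>..\<beta>}) :: real)"
  shows "\<bar>sum (edge_weight w) (farey_neighbours Q) - 3 * sum w (farey_fracs Q)\<bar> \<le> 4 * real Q"
  using assms(1)
proof (induction Q rule: nat_induct_at_least)
  case base
  have "w (0, 1) \<in> {0, 1}" "w (1, 1) \<in> {0, 1}" by (auto simp: w_def)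
  then show ?case by (auto simp: farey_neighbours_1[simplified] farey_fracs_1[simplified] edge_weight_def den_ratio_def)
next
  case (Suc Q)
  define D where "D = {(x, y) \<in> farey_neighbours Q. snd x + snd y = int Q + 1}"
  have "\<bar>\<Sum>(x, y)\<in>D. w x + w y - 2 * w (mediant x y)\<bar> \<le> 2 * 2"
  proof (rule sum_crossing_neighbours_le)
    fix e assume e: "e \<in> D" "e \<notin> crossing_neighbours Q \<alpha> \<beta>"
    obtain x y where [simp]: "e = (x, y)" by (metis surj_pair)
    have xy: "(x, y) \<in> farey_neighbours Q" using e by (simp add: D_def)
    then have "snd x > 0" "snd y > 0" "fst y * snd x - fst x * snd y = 1"
      by (auto simp: farey_neighbours_def)
    then have "frac_value x < frac_value (mediant x y)" "frac_value (mediant x y) < frac_value y"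
      by (simp_all add: frac_value_less_iff mediant_def algebra_simps)
    then show "(case e of (x, y) \<Rightarrow> w x + w y - 2 * w (mediant x y)) = 0"
      using e(2) xy by (auto simp: w_def crossing_neighbours_def)
  qed (auto simp: D_def w_def)
  then show ?case
    using Suc.IH sum_edge_weight_Suc[OF Suc.hyps, of w] unfolding D_def by simp
qed

text \<open>Edge weights differ from the sum over pairs inside the interval only at crossing pairs,
  each time by at most one ratio of denominators, hence by at most \<open>Q\<close>. This adds
  \<open>2 Q\<close> to the previous \<open>4 Q\<close>.\<close>

lemma farey_neighbours_sum_ratio:
  assumes "Q \<ge> 1"
  shows "\<bar>(\<Sum>(x, y)\<in>farey_neighbours Q \<inter> fracs_in Q \<alpha> \<beta> \<times> fracs_in Q \<alpha> \<beta>. den_ratio x y + den_ratio y x)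
    - 3 * real (card (fracs_in Q \<alpha> \<beta>))\<bar> \<le> 6 * real Q"
proof -
  define w where "w = (\<lambda>x. of_bool (frac_value x \<in> {\<alpha>..\<beta>}) :: real)"
  define r where "r = (\<lambda>(x :: fraction, y :: fraction). den_ratio x y + den_ratio y x :: real)"
  define v where "v e = (if e \<in> fracs_in Q \<alpha> \<beta> \<times> fracs_in Q \<alpha> \<beta> then r e else 0)" for e
  have card: "sum w (farey_fracs Q) = real (card (fracs_in Q \<alpha> \<beta>))"
    using finite_farey_fracs[of Q] by (simp add: w_def fracs_in_def Int_def)
  have "\<bar>\<Sum>e\<in>farey_neighbours Q. edge_weight w e - v e\<bar> \<le> 2 * real Q"
  proof (rule sum_crossing_neighbours_le)
    fix e assume e: "e \<in> farey_neighbours Q"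
    obtain x y where [simp]: "e = (x, y)" by (metis surj_pair)
    have mem: "x \<in> farey_fracs Q" "y \<in> farey_fracs Q" using subsetD[OF farey_neighbours_subset e] by simp_all
    have ratio: "0 \<le> den_ratio x y" "den_ratio x y \<le> real Q" if "x \<in> farey_fracs Q" "y \<in> farey_fracs Q" for x y
    proof -
      have xy: "1 \<le> snd x" "snd x \<le> int Q" "1 \<le> snd y" using that by (auto simp: farey_fracs_def)
      have "real_of_int (snd x) / real_of_int (snd y) \<le> real_of_int (snd x) / 1"
        using xy by (intro divide_left_mono) auto
      also have "\<dots> \<le> real Q" using xy by simp
      finally show "den_ratio x y \<le> real Q" by (simp add: den_ratio_def)
      show "0 \<le> den_ratio x y" using xy by (simp add: den_ratio_def)
    qed
    have w: "w x \<in> {0, 1}" "w y \<in> {0, 1}" by (auto simp: w_def)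
    have v: "v e = w x * w y * (den_ratio x y + den_ratio y x)"
      using mem by (auto simp: v_def w_def fracs_in_def r_def)
    show "\<bar>edge_weight w e - v e\<bar> \<le> real Q"
      using w ratio[OF mem] ratio[OF mem(2,1)] unfolding v by (auto simp: edge_weight_def)
    assume "e \<notin> crossing_neighbours Q \<alpha> \<beta>"
    then have "w x = w y" using e farey_neighbours_less[of x y Q]
      by (auto simp: crossing_neighbours_def w_def)
    then show "edge_weight w e - v e = 0" using w unfolding v by (auto simp: edge_weight_def)
  qed auto
  moreover have "(\<Sum>e\<in>farey_neighbours Q. v e) = sum r (farey_neighbours Q \<inter> fracs_in Q \<alpha> \<beta> \<times> fracs_in Q \<alpha> \<beta>)"
    using finite_farey_neighbours[of Q] by (simp add: v_def sum.inter_restrict)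
  ultimately show ?thesis
    using sum_edge_weight_indicator[OF assms, of \<alpha> \<beta>, folded w_def]
    unfolding sum_subtractf card r_def by linarith
qed

subsection \<open>Consecutive fractions in an interval\<close>

lemma frac_value_quotient_of: "frac_value (quotient_of r) = of_rat r"
proof -
  obtain p q where pq: "quotient_of r = (p, q)" by (metis surj_pair)
  then have "r = of_int p / of_int q" by (rule quotient_of_div)
  then show ?thesis using pq by (simp add: frac_value_def of_rat_divide)
qed

lemma quotient_of_farey: "quotient_of ` farey Q = farey_fracs Q"
proof -
  have *: "quotient_of (of_int p / of_int q) = (p, q)" if "q > 0" "coprime p q" for p q :: int
    using that by (simp add: quotient_of_Fract normalize_stable flip: Fract_of_int_quotient)
  show ?thesis
  proof (intro equalityI subsetI)
    fix x assume "x \<in> quotient_of ` farey Q"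
    then obtain p q where pq: "x = quotient_of (of_nat p / of_nat q)" "p \<le> q" "q \<le> Q" "1 \<le> q" "coprime p q"
      by (auto simp: farey_def)
    then have "x = (int p, int q)" using *[of "int q" "int p"] by simp
    then show "x \<in> farey_fracs Q" using pq by (simp add: farey_fracs_def)
  next
    fix x assume x: "x \<in> farey_fracs Q"
    obtain p q where [simp]: "x = (p, q)" by (metis surj_pair)
    have pq: "0 \<le> p" "p \<le> q" "1 \<le> q" "q \<le> int Q" "coprime p q" using x by (simp_all add: farey_fracs_def)
    have "of_int p / of_int q = (of_nat (nat p) / of_nat (nat q) :: rat)" using pq by simp
    moreover have "nat p \<le> nat q \<and> nat q \<le> Q \<and> 1 \<le> nat q \<and> coprime (nat p) (nat q)"
      using pq by (auto simp flip: coprime_int_iff)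
    ultimately have "of_int p / of_int q \<in> farey Q" unfolding farey_def by blast
    moreover have "x = quotient_of (of_int p / of_int q)" using *[of q p] pq by simp
    ultimately show "x \<in> quotient_of ` farey Q" by blast
  qed
qed

lemma quotient_of_farey_in: "quotient_of ` farey_in Q \<alpha> \<beta> = fracs_in Q \<alpha> \<beta>"
  unfolding fracs_in_def quotient_of_farey[symmetric]
  by (auto simp: farey_in_def frac_value_quotient_of)

lemma inj_quotient_of: "inj quotient_of"
  by (simp add: inj_def quotient_of_inject)

lemma finite_farey_in: "finite (farey_in Q \<alpha> \<beta>)"
proof -
  have "finite (quotient_of ` farey_in Q \<alpha> \<beta>)"
    unfolding quotient_of_farey_in fracs_in_def using finite_farey_fracs by simp
  then show ?thesis using inj_quotient_of by (metis finite_imageD inj_on_subset subset_UNIV)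
qed

text \<open>Indexed from 0, unlike \<open>farey_den\<close>, so the \<open>j\<close>-th term of the
  moment involves the indices \<open>j - 1\<close> and \<open>j\<close>.\<close>

definition farey_nth :: "nat \<Rightarrow> real \<Rightarrow> real \<Rightarrow> nat \<Rightarrow> fraction" where
  "farey_nth Q \<alpha> \<beta> i = quotient_of (sorted_list_of_set (farey_in Q \<alpha> \<beta>) ! i)"

lemma farey_nth_image: "farey_nth Q \<alpha> \<beta> ` {..<farey_count Q \<alpha> \<beta>} = fracs_in Q \<alpha> \<beta>"
proof -
  have "(!) (sorted_list_of_set (farey_in Q \<alpha> \<beta>)) ` {..<farey_count Q \<alpha> \<beta>} = farey_in Q \<alpha> \<beta>"
    using finite_farey_in[of Q \<alpha> \<beta>] nth_image[of "farey_count Q \<alpha> \<beta>" "sorted_list_of_set (farey_in Q \<alpha> \<beta>)"]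
    by (simp add: farey_count_def lessThan_atLeast0)
  then show ?thesis unfolding quotient_of_farey_in[symmetric] farey_nth_def by (metis image_image)
qed

lemma farey_nth_less_iff:
  assumes "i < farey_count Q \<alpha> \<beta>" "k < farey_count Q \<alpha> \<beta>"
  shows "frac_value (farey_nth Q \<alpha> \<beta> i) < frac_value (farey_nth Q \<alpha> \<beta> k) \<longleftrightarrow> i < k"
proof -
  have *: "frac_value (farey_nth Q \<alpha> \<beta> i) < frac_value (farey_nth Q \<alpha> \<beta> k)"
    if "i < k" "k < farey_count Q \<alpha> \<beta>" for i k
    using that finite_farey_in[of Q \<alpha> \<beta>]
    by (auto simp: farey_nth_def frac_value_quotient_of of_rat_less farey_count_def
        intro!: sorted_wrt_nth_less[OF strict_sorted_list_of_set])
  show ?thesis using *[of i k] *[of k i] assms by (cases i k rule: linorder_cases) auto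
qed

text \<open>The algebraic successor of an enumerated fraction cannot lie beyond the next one, so it
  stays in the interval and must be that next one. Conversely, an index gap would put a fraction
  between neighbours.\<close>

lemma bij_betw_farey_neighbours:
  "bij_betw (\<lambda>j. (farey_nth Q \<alpha> \<beta> (j - 1), farey_nth Q \<alpha> \<beta> j)) {1..<farey_count Q \<alpha> \<beta>}
     (farey_neighbours Q \<inter> fracs_in Q \<alpha> \<beta> \<times> fracs_in Q \<alpha> \<beta>)"
    (is "bij_betw ?g ?J ?P")
proof (rule bij_betw_imageI)
  let ?x = "farey_nth Q \<alpha> \<beta>" and ?N = "farey_count Q \<alpha> \<beta>"
  have mem: "?x i \<in> fracs_in Q \<alpha> \<beta>" if "i < ?N" for i using farey_nth_image[of Q \<alpha> \<beta>] that by blast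
  have ex: "\<exists>i<?N. z = ?x i" if "z \<in> fracs_in Q \<alpha> \<beta>" for z using farey_nth_image[of Q \<alpha> \<beta>] that by blast
  show "inj_on ?g ?J"
  proof (rule inj_onI)
    fix j k assume jk: "j \<in> ?J" "k \<in> ?J" "?g j = ?g k"
    then show "j = k" using farey_nth_less_iff[of j Q \<alpha> \<beta> k] farey_nth_less_iff[of k Q \<alpha> \<beta> j]
      by (auto intro: linorder_cases[of j k])
  qed
  show "?g ` ?J = ?P"
  proof (intro equalityI subsetI)
    fix e assume "e \<in> ?g ` ?J"
    then obtain j where j: "1 \<le> j" "j < ?N" and e: "e = (?x (j - 1), ?x j)" by auto
    have less: "frac_value (?x (j - 1)) < frac_value (?x j)"
      using j by (subst farey_nth_less_iff) auto
    have x: "?x (j - 1) \<in> fracs_in Q \<alpha> \<beta>" "?x j \<in> fracs_in Q \<alpha> \<beta>" using j by (auto intro: mem)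
    have "frac_value (?x j) \<le> 1" using x(2) by (auto simp: fracs_in_def farey_fracs_def frac_value_def)
    then have "frac_value (?x (j - 1)) < 1" using less by simp
    then have "fst (?x (j - 1)) < snd (?x (j - 1))" using x(1)
      by (auto simp: fracs_in_def farey_fracs_def frac_value_def)
    then obtain z where z: "(?x (j - 1), z) \<in> farey_neighbours Q"
      using ex_farey_successor[of "?x (j - 1)" Q] x(1) by (auto simp: fracs_in_def)
    have zj: "frac_value z \<le> frac_value (?x j)"
      using farey_neighbours_no_between[OF z _ less] x(2) by (simp add: fracs_in_def)
    have zgt: "frac_value (?x (j - 1)) < frac_value z" using z by (rule farey_neighbours_less)
    have "z \<in> farey_fracs Q" using subsetD[OF farey_neighbours_subset z] by simp
    then have "z \<in> fracs_in Q \<alpha> \<beta>" using zj zgt x by (auto simp: fracs_in_def)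
    then obtain k where k: "k < ?N" "z = ?x k" using ex by blast
    have "j - 1 < k" using zgt k j farey_nth_less_iff[of "j - 1" Q \<alpha> \<beta> k] by simp
    moreover have "\<not> j < k" using zj k j farey_nth_less_iff[of j Q \<alpha> \<beta> k] by simp
    ultimately have "k = j" by linarith
    then have "z = ?x j" using k by simp
    then show "e \<in> ?P" using e z x by simp
  next
    fix e assume e: "e \<in> ?P"
    obtain x y where [simp]: "e = (x, y)" by (metis surj_pair)
    obtain i k where ik: "i < ?N" "x = ?x i" "k < ?N" "y = ?x k" using ex[of x] ex[of y] e by auto
    have "i < k" using farey_neighbours_less[of x y Q] e ik farey_nth_less_iff[of i Q \<alpha> \<beta> k] by simp
    moreover have "\<not> Suc i < k"
    proof
      assume "Suc i < k"
      then have "frac_value x < frac_value (?x (Suc i))" "frac_value (?x (Suc i)) < frac_value y"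
        using ik by (simp_all add: farey_nth_less_iff)
      moreover have "?x (Suc i) \<in> farey_fracs Q" using mem[of "Suc i"] ik \<open>Suc i < k\<close> by (simp add: fracs_in_def)
      ultimately show False using farey_neighbours_no_between[of x y Q "?x (Suc i)"] e by auto
    qed
    ultimately have "k = Suc i" by simp
    then have "e = ?g k" "k \<in> ?J" using ik by auto
    then show "e \<in> ?g ` ?J" by blast
  qed
qed

lemma farey_moment_eq:
  assumes "farey_order \<delta> = Q"
  shows "farey_moment (\<lambda>x y. 1 / 2 * (x / y + y / x)) \<alpha> \<beta> \<delta>
    = 1 / (2 * (\<beta> - \<alpha>)) * (\<Sum>(x, y)\<in>farey_neighbours Q \<inter> fracs_in Q \<alpha> \<beta> \<times> fracs_in Q \<alpha> \<beta>. den_ratio x y + den_ratio y x)"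
proof -
  have "(\<Sum>j\<in>{1..<farey_count Q \<alpha> \<beta>}. \<bar>1 / 2 * (real_of_int (farey_den Q \<alpha> \<beta> j) / real Q / (real_of_int (farey_den Q \<alpha> \<beta> (j + 1)) / real Q)
      + real_of_int (farey_den Q \<alpha> \<beta> (j + 1)) / real Q / (real_of_int (farey_den Q \<alpha> \<beta> j) / real Q))\<bar>)
    = (\<Sum>j\<in>{1..<farey_count Q \<alpha> \<beta>}. (\<lambda>(x, y). 1 / 2 * (den_ratio x y + den_ratio y x)) (farey_nth Q \<alpha> \<beta> (j - 1), farey_nth Q \<alpha> \<beta> j))"
  proof (rule sum.cong[OF refl])
    fix j assume j: "j \<in> {1..<farey_count Q \<alpha> \<beta>}"
    \<comment> \<open>Positivity of \<open>Q\<close> and of both denominators cancels the scaling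
      and removes the absolute value.\<close>
    have "(farey_nth Q \<alpha> \<beta> (j - 1), farey_nth Q \<alpha> \<beta> j) \<in> farey_neighbours Q"
      using bij_betwE[OF bij_betw_farey_neighbours] j by blast
    then have "snd (farey_nth Q \<alpha> \<beta> (j - 1)) > 0" "snd (farey_nth Q \<alpha> \<beta> j) > 0" "Q > 0"
      by (auto simp: farey_neighbours_def)
    then show "\<bar>1 / 2 * (real_of_int (farey_den Q \<alpha> \<beta> j) / real Q / (real_of_int (farey_den Q \<alpha> \<beta> (j + 1)) / real Q)
      + real_of_int (farey_den Q \<alpha> \<beta> (j + 1)) / real Q / (real_of_int (farey_den Q \<alpha> \<beta> j) / real Q))\<bar>
      = (\<lambda>(x, y). 1 / 2 * (den_ratio x y + den_ratio y x)) (farey_nth Q \<alpha> \<beta> (j - 1), farey_nth Q \<alpha> \<beta> j)"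
      by (simp add: farey_den_def den_ratio_def flip: farey_nth_def)
  qed
  also have "\<dots> = (\<Sum>(x, y)\<in>farey_neighbours Q \<inter> fracs_in Q \<alpha> \<beta> \<times> fracs_in Q \<alpha> \<beta>. 1 / 2 * (den_ratio x y + den_ratio y x))"
    by (rule sum.reindex_bij_betw[OF bij_betw_farey_neighbours])
  finally show ?thesis
    unfolding farey_moment_def assms Let_def by (simp add: case_prod_unfold flip: sum_divide_distrib)
qed

subsection \<open>Counting fractions in an interval\<close>

text \<open>The denominator comes first here, so that the set is a \<open>SIGMA\<close>.\<close>

definition lattice_points :: "nat \<Rightarrow> real \<Rightarrow> real \<Rightarrow> fraction set" where
  "lattice_points n \<alpha> \<beta> = (SIGMA q:{1..int n}. {\<lceil>\<alpha> * q\<rceil>..\<lfloor>\<beta> * q\<rfloor>})"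

lemma card_lattice_points:
  assumes "\<alpha> \<le> \<beta>"
  shows "\<bar>real (card (lattice_points n \<alpha> \<beta>)) - (\<beta> - \<alpha>) / 2 * (real n)\<^sup>2\<bar> \<le> (1 + \<bar>\<beta> - \<alpha>\<bar>) * real n"
proof -
  define c where "c q = real (card {\<lceil>\<alpha> * real q\<rceil>..\<lfloor>\<beta> * real q\<rfloor>})" for q
  have c: "\<bar>c q - (\<beta> - \<alpha>) * real q\<bar> \<le> 1" for q
  proof -
    have "\<alpha> * real q \<le> \<beta> * real q" using assms by (intro mult_right_mono) auto
    \<comment> \<open>The slack of 1 keeps the cardinality formula valid when the integer range is
      empty.\<close>
    then have "\<lceil>\<alpha> * real q\<rceil> \<le> \<lfloor>\<beta> * real q\<rfloor> + 1" by linarith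
    then have "c q = of_int (\<lfloor>\<beta> * real q\<rfloor> + 1 - \<lceil>\<alpha> * real q\<rceil>)" by (simp add: c_def)
    then show ?thesis by (simp add: algebra_simps) linarith
  qed
  have "real (card (lattice_points n \<alpha> \<beta>)) = (\<Sum>q\<in>{1..int n}. real (card {\<lceil>\<alpha> * q\<rceil>..\<lfloor>\<beta> * q\<rfloor>}))"
    by (simp add: lattice_points_def)
  also have "\<dots> = (\<Sum>q=1..n. c q)"
    by (rule sum.reindex_bij_witness[of _ int nat]) (auto simp: c_def)
  finally have card: "real (card (lattice_points n \<alpha> \<beta>)) = (\<Sum>q=1..n. c q)" .
  have gauss: "(\<Sum>q=1..n. real q) = real n * (real n + 1) / 2"
    by (induction n) (auto simp: field_simps)
  have "(\<Sum>q=1..n. c q - (\<beta> - \<alpha>) * real q)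
    = real (card (lattice_points n \<alpha> \<beta>)) - (\<beta> - \<alpha>) * (real n * (real n + 1) / 2)"
    by (simp only: card gauss sum_subtractf flip: sum_distrib_left)
  also have "\<dots> = real (card (lattice_points n \<alpha> \<beta>)) - (\<beta> - \<alpha>) / 2 * (real n)\<^sup>2 - (\<beta> - \<alpha>) / 2 * real n"
    by (simp add: field_simps power2_eq_square)
  finally have "real (card (lattice_points n \<alpha> \<beta>)) - (\<beta> - \<alpha>) / 2 * (real n)\<^sup>2 - (\<beta> - \<alpha>) / 2 * real n
    = (\<Sum>q=1..n. c q - (\<beta> - \<alpha>) * real q)" by simp
  also have "\<bar>\<dots>\<bar> \<le> (\<Sum>q=1..n. 1)" using c by (intro order.trans[OF sum_abs] sum_mono) auto
  finally have "\<bar>real (card (lattice_points n \<alpha> \<beta>)) - (\<beta> - \<alpha>) / 2 * (real n)\<^sup>2 - (\<beta> - \<alpha>) / 2 * real n\<bar> \<le> real n"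
    by simp
  moreover define y where "y = (\<beta> - \<alpha>) / 2 * real n"
  moreover have "y \<ge> 0" "(1 + \<bar>\<beta> - \<alpha>\<bar>) * real n = real n + 2 * y"
    using assms by (simp_all add: y_def distrib_right)
  ultimately show ?thesis by linarith
qed

text \<open>Dividing a lattice point by its gcd \<open>d\<close> leaves a reduced fraction of the
  same value with denominator at most \<open>n div d\<close>. The location of the interval in
  \<open>[0, 1]\<close> makes that fraction a Farey fraction.\<close>

lemma card_lattice_points_eq_sum:
  assumes "0 \<le> \<alpha>" "\<beta> \<le> 1"
  shows "card (lattice_points n \<alpha> \<beta>) = (\<Sum>d=1..n. card (fracs_in (n div d) \<alpha> \<beta>))"
proof -
  have fin: "finite (fracs_in m \<alpha> \<beta>)" for m using finite_farey_fracs[of m] by (simp add: fracs_in_def)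
  have in_iff: "frac_value (p, q) \<in> {\<alpha>..\<beta>} \<longleftrightarrow> \<lceil>\<alpha> * q\<rceil> \<le> p \<and> p \<le> \<lfloor>\<beta> * q\<rfloor>" if "q > 0" for p q :: int
    using that by (auto simp: frac_value_def field_simps ceiling_le_iff le_floor_iff)
  let ?f = "\<lambda>(d, (p, q)). (int d * q, int d * p)"
  let ?g = "\<lambda>(q, p). (nat (gcd p q), (p div gcd p q, q div gcd p q))"
  have "bij_betw ?f (SIGMA d:{1..n}. fracs_in (n div d) \<alpha> \<beta>) (lattice_points n \<alpha> \<beta>)"
  proof (rule bij_betw_byWitness[where f' = ?g]; (intro ballI image_subsetI)?)
    fix e assume "e \<in> (SIGMA d:{1..n}. fracs_in (n div d) \<alpha> \<beta>)"
    then obtain d p q where [simp]: "e = (d, (p, q))" and d: "1 \<le> d" "d \<le> n" and x: "(p, q) \<in> fracs_in (n div d) \<alpha> \<beta>"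
      by auto
    have pq: "0 \<le> p" "p \<le> q" "1 \<le> q" "q \<le> int (n div d)" "coprime p q" "frac_value (p, q) \<in> {\<alpha>..\<beta>}"
      using x by (auto simp: fracs_in_def farey_fracs_def)
    have "gcd (int d * p) (int d * q) = int d"
      using pq(5) by (simp add: gcd_mult_left)
    then show "?g (?f e) = e" using d by simp
    have "int d * q \<le> int d * int (n div d)" using pq by (intro mult_left_mono) auto
    also have "\<dots> \<le> int n" by (metis of_nat_le_iff of_nat_mult times_div_less_eq_dividend)
    finally have "int d * q \<le> int n" .
    moreover have "1 * 1 \<le> int d * q" using d pq by (intro mult_mono) auto
    moreover have "frac_value (int d * p, int d * q) = frac_value (p, q)"
      using d by (simp add: frac_value_def)
    ultimately show "?f e \<in> lattice_points n \<alpha> \<beta>"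
      using in_iff[of "int d * q" "int d * p"] pq(6) by (simp add: lattice_points_def)
  next
    fix e assume e: "e \<in> lattice_points n \<alpha> \<beta>"
    obtain p q where [simp]: "e = (q, p)" by (metis surj_pair)
    have q: "1 \<le> q" "q \<le> int n" and I: "frac_value (p, q) \<in> {\<alpha>..\<beta>}"
      using e in_iff[of q p] by (auto simp: lattice_points_def)
    define d where "d = gcd p q"
    have d: "d \<ge> 1" using q by (simp add: d_def Orderings.order_class.less_le int_one_le_iff_zero_less)
    obtain a b where ab: "p = d * a" "q = d * b" using d_def by (metis dvdE gcd_dvd1 gcd_dvd2)
    have "coprime (p div d) (q div d)" unfolding d_def using q by (intro div_gcd_coprime) auto
    then have cop: "coprime a b" using ab d by simp
    have "0 < d * b" using q ab by simp
    then have b: "1 \<le> b" using d by (simp add: zero_less_mult_iff)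
    have "1 * b \<le> d * b" "d * 1 \<le> d * b" using d b by (auto intro!: mult_right_mono mult_left_mono)
    then have dn: "nat d \<le> n" using q ab by linarith
    have "d * b div d \<le> int n div d" using q ab d by (intro zdiv_mono1) auto
    then have "b \<le> int n div d" using d by simp
    moreover have v: "frac_value (a, b) = frac_value (p, q)" using ab d by (simp add: frac_value_def)
    moreover have "0 \<le> a \<and> a \<le> b"
    proof -
      have "0 \<le> frac_value (a, b)" "frac_value (a, b) \<le> 1" using I v assms by auto
      then show ?thesis using b by (simp add: frac_value_def zero_le_divide_iff)
    qed
    ultimately have "(a, b) \<in> fracs_in (n div nat d) \<alpha> \<beta>"
      using b cop I d by (simp add: fracs_in_def farey_fracs_def zdiv_int)
    moreover have g: "?g e = (nat d, (a, b))"
    proof -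
      have "?g e = (nat d, (p div d, q div d))" by (simp add: d_def)
      then show ?thesis using ab d by simp
    qed
    ultimately show "?g e \<in> (SIGMA d:{1..n}. fracs_in (n div d) \<alpha> \<beta>)" using dn d by simp
    show "?f (?g e) = e" unfolding g using ab d by simp
  qed
  then have "card (lattice_points n \<alpha> \<beta>) = card (SIGMA d:{1..n}. fracs_in (n div d) \<alpha> \<beta>)"
    by (rule bij_betw_same_card[symmetric])
  then show ?thesis using fin by simp
qed

lemma card_fracs_in_asymptotic:
  assumes "0 \<le> \<alpha>" "\<alpha> \<le> \<beta>" "\<beta> \<le> 1"
  shows "\<exists>C. \<forall>n. \<bar>real (card (fracs_in n \<alpha> \<beta>)) - 3 * (\<beta> - \<alpha>) / pi\<^sup>2 * (real n)\<^sup>2\<bar> \<le> C * real n powr (7/4)"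
proof -
  have "\<exists>C. \<forall>n. \<bar>real (card (fracs_in n \<alpha> \<beta>)) - 6 * ((\<beta> - \<alpha>) / 2) / pi\<^sup>2 * (real n)\<^sup>2\<bar> \<le> C * real n powr (7/4)"
  proof (rule count_asymptotic_of_divisor_sum)
    fix n
    have "real n \<le> real n powr (7/4)"
      using powr_mono[of 1 "7/4" "real n"] by (cases "n = 0") auto
    then have "(1 + \<bar>\<beta> - \<alpha>\<bar>) * real n \<le> (1 + \<bar>\<beta> - \<alpha>\<bar>) * real n powr (7/4)"
      by (intro mult_left_mono) auto
    then show "\<bar>(\<Sum>d=1..n. real (card (fracs_in (n div d) \<alpha> \<beta>))) - (\<beta> - \<alpha>) / 2 * (real n)\<^sup>2\<bar>
        \<le> (1 + \<bar>\<beta> - \<alpha>\<bar>) * real n powr (7/4)"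
      using card_lattice_points[OF assms(2), of n] card_lattice_points_eq_sum[OF assms(1,3), of n] by simp
  next
    have "fracs_in 0 \<alpha> \<beta> = {}" by (auto simp: fracs_in_def farey_fracs_def)
    then show "real (card (fracs_in 0 \<alpha> \<beta>)) = 0" by simp
  qed
  moreover have "6 * ((\<beta> - \<alpha>) / 2) / pi\<^sup>2 = 3 * (\<beta> - \<alpha>) / pi\<^sup>2" by (simp add: field_simps)
  ultimately show ?thesis by metis
qed

section \<open>Combining the index sum with the count\<close>

theorem theorem1p2:
  fixes \<alpha> \<beta> \<epsilon> :: real
  assumes "0 \<le> \<alpha>" and "\<alpha> < \<beta>" and "\<beta> \<le> 1" and "\<epsilon> > 0"
  shows "(\<lambda>\<delta>. farey_moment (\<lambda>x y. 1 / 2 * (x / y + y / x)) \<alpha> \<beta> \<delta>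
                - 9 / (2 * pi\<^sup>2) * (real (farey_order \<delta>))\<^sup>2)
           \<in> O[at_right 0](\<lambda>\<delta>. real (farey_order \<delta>) powr (7 / 4 + \<epsilon>))"
proof -
  obtain C where C: "\<bar>real (card (fracs_in n \<alpha> \<beta>)) - 3 * (\<beta> - \<alpha>) / pi\<^sup>2 * (real n)\<^sup>2\<bar> \<le> C * real n powr (7/4)" for n
    using card_fracs_in_asymptotic[of \<alpha> \<beta>] assms by auto
  \<comment> \<open>The 6 comes from the index sum and \<open>3 * C\<close> from three times the
    count; the divisor is the normalisation \<open>2 |I|\<close> of the moment.\<close>
  define K where "K = (6 + 3 * C) / (2 * (\<beta> - \<alpha>))"
  have K: "K \<ge> 0"
  proof -
    have "0 \<le> C * real 1 powr (7/4)" using C[of 1] abs_ge_zero order.trans by blast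
    then show ?thesis using assms by (simp add: K_def)
  qed
  have bound: "\<bar>farey_moment (\<lambda>x y. 1 / 2 * (x / y + y / x)) \<alpha> \<beta> \<delta> - 9 / (2 * pi\<^sup>2) * (real (farey_order \<delta>))\<^sup>2\<bar>
      \<le> K * real (farey_order \<delta>) powr (7 / 4 + \<epsilon>)" for \<delta>
  \<comment> \<open>For order 0 both sides vanish, with \<open>0 powr x = 0\<close>, so the bound
    holds for every real \<open>\<delta>\<close>.\<close>
  proof (cases "farey_order \<delta> = 0")
    case True
    have "farey_neighbours 0 = {}" by (auto simp: farey_neighbours_def)
    then show ?thesis unfolding farey_moment_eq[OF True] True by simp
  next
    case False
    define Q where "Q = farey_order \<delta>"
    then have Q: "Q \<ge> 1" using False by simp
    define S where "S = (\<Sum>(x, y)\<in>farey_neighbours Q \<inter> fracs_in Q \<alpha> \<beta> \<times> fracs_in Q \<alpha> \<beta>. den_ratio x y + den_ratio y x)"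
    define A P where "A = 3 * (\<beta> - \<alpha>) / pi\<^sup>2 * (real Q)\<^sup>2" and "P = real Q powr (7/4)"
    have "real Q powr 1 \<le> P" unfolding P_def using Q by (intro powr_mono) auto
    moreover have "9 * (\<beta> - \<alpha>) / pi\<^sup>2 * (real Q)\<^sup>2 = 3 * A" by (simp add: A_def)
    ultimately have "\<bar>S - 9 * (\<beta> - \<alpha>) / pi\<^sup>2 * (real Q)\<^sup>2\<bar> \<le> 6 * P + 3 * (C * P)"
      using farey_neighbours_sum_ratio[OF Q, of \<alpha> \<beta>, folded S_def] C[of Q, folded A_def P_def] Q
      unfolding abs_le_iff by simp
    then have "\<bar>S - 9 * (\<beta> - \<alpha>) / pi\<^sup>2 * (real Q)\<^sup>2\<bar> \<le> (6 + 3 * C) * real Q powr (7/4)"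
      by (simp add: P_def distrib_right mult.assoc)
    moreover have "farey_moment (\<lambda>x y. 1 / 2 * (x / y + y / x)) \<alpha> \<beta> \<delta> - 9 / (2 * pi\<^sup>2) * (real Q)\<^sup>2
        = (S - 9 * (\<beta> - \<alpha>) / pi\<^sup>2 * (real Q)\<^sup>2) / (2 * (\<beta> - \<alpha>))"
    proof -
      have "9 / (2 * pi\<^sup>2) * x = 9 * l / pi\<^sup>2 * x / (2 * l)" if "l > 0" for l x :: real
        using that by (simp add: field_simps)
      from this[of "\<beta> - \<alpha>"] show ?thesis
        unfolding farey_moment_eq[OF Q_def[symmetric]] S_def[symmetric] diff_divide_distrib
        using assms(2) by simp
    qed
    ultimately have "\<bar>farey_moment (\<lambda>x y. 1 / 2 * (x / y + y / x)) \<alpha> \<beta> \<delta> - 9 / (2 * pi\<^sup>2) * (real Q)\<^sup>2\<bar>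
        \<le> K * real Q powr (7/4)"
      using assms(2) by (simp add: K_def abs_divide divide_right_mono)
    \<comment> \<open>Since \<open>Q \<ge> 1\<close>, raising the exponent only weakens the
      bound.\<close>
    also have "\<dots> \<le> K * real Q powr (7/4 + \<epsilon>)"
      using Q K assms(4) by (intro mult_left_mono powr_mono) auto
    finally show ?thesis by (simp add: Q_def)
  qed
  show ?thesis
    by (rule bigoI[where c = K], rule always_eventually) (use bound in simp)
qed

end
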